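(* For every tree $T$ we have $\overleftrightarrow{\chi}(T) \leq 3$, and this bound is sharp, i.e. there exists a tree $T$ with $\overleftrightarrow{\chi}(T) = 3$.
   Context: All graphs are finite and simple. An orientation $D$ of a graph $G$ is a digraph obtained by replacing each edge of $G$ by exactly one of the two possible arcs with the same endvertices. For a vertex $v$, $d_D^-(v)$ (in-degree) is the number of arcs with head $v$, $d_D^+(v)$ (out-degree) is the number of arcs with tail $v$, and the in-out-degree is $d_D^{\pm}(v) = d_D^-(v) - d_D^+(v)$. An orientation $D$ of $G$ is in-out-proper if $d_D^{\pm}(u) \neq d_D^{\pm}(v)$ for any two adjacent vertices $u,v$. The in-out-proper orientation number of $G$ is $\overleftrightarrow{\chi}(G) = \min_{D\in\Gamma}\max_{v\in V(G)} |d_D^{\pm}(v)|$, where $\Gamma$ is the set of in-out-proper orientations of $G$ (it is known that $\Gamma$ is nonempty for every graph $G$). *)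

theory Defs
  imports "Graph_Theory.Graph_Theory"
begin

text \<open>
  A finite simple graph is a \<^locale>\<open>pair_graph\<close>: a finite, loop-free, symmetric set of vertex
  pairs, where an edge \<open>uv\<close> is represented by the two pairs \<open>(u, v)\<close> and \<open>(v, u)\<close>.

  The library's \<^const>\<open>Digraph_Component.tree\<close> is unsuitable for such graphs: it forbids directed
  cycles, and every edge of a symmetric digraph gives the directed cycle \<open>u, v, u\<close>. Since a
  \<^const>\<open>pre_digraph.cycle\<close> has no repeated vertices, the cycles of the simple graph are precisely
  those of length at least 3. By definition of \<^const>\<open>connected\<close>, the null graph is not a tree.
\<close>

definition simple_tree :: "'a pair_pre_digraph \<Rightarrow> bool" where
  "simple_tree G \<longleftrightarrow>
     pair_graph G \<and> connected (with_proj G) \<and>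
     \<not> (\<exists>p. pre_digraph.cycle (with_proj G) p \<and> 3 \<le> length p)"

definition orientation :: "'a pair_pre_digraph \<Rightarrow> 'a pair_pre_digraph \<Rightarrow> bool" where
  "orientation G D \<longleftrightarrow>
     pverts D = pverts G \<and> parcs D \<subseteq> parcs G \<and>
     (\<forall>(u, v) \<in> parcs G. (u, v) \<in> parcs D \<longleftrightarrow> (v, u) \<notin> parcs D)"

definition in_out_degree :: "'a pair_pre_digraph \<Rightarrow> 'a \<Rightarrow> int" where
  "in_out_degree D v = int (in_degree (with_proj D) v) - int (out_degree (with_proj D) v)"

definition in_out_proper_orientation :: "'a pair_pre_digraph \<Rightarrow> 'a pair_pre_digraph \<Rightarrow> bool" where
  "in_out_proper_orientation G D \<longleftrightarrow>
     orientation G D \<and> (\<forall>(u, v) \<in> parcs G. in_out_degree D u \<noteq> in_out_degree D v)"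

text \<open>
  Meaningful for graphs with at least one vertex: \<^const>\<open>Max\<close> is unspecified on the empty set.
\<close>

definition in_out_proper_orientation_number :: "'a pair_pre_digraph \<Rightarrow> int" where
  "in_out_proper_orientation_number G =
     Min ((\<lambda>D. Max ((\<lambda>v. \<bar>in_out_degree D v\<bar>) ` pverts G)) ` {D. in_out_proper_orientation G D})"

text \<open>
  The minimum ranges over a finite set, as \<^const>\<open>Min\<close> requires.
\<close>

lemma finite_in_out_proper_orientations:
  assumes "pair_graph G"
  shows "finite {D. in_out_proper_orientation G D}"
proof -
  interpret pair_graph G by fact
  have "{D. in_out_proper_orientation G D}
      \<subseteq> (\<lambda>A. \<lparr>pverts = pverts G, parcs = A\<rparr>) ` Pow (parcs G)"
  proof
    fix D assume "D \<in> {D. in_out_proper_orientation G D}"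
    then have "pverts D = pverts G" "parcs D \<subseteq> parcs G"
      by (auto simp: in_out_proper_orientation_def orientation_def)
    then show "D \<in> (\<lambda>A. \<lparr>pverts = pverts G, parcs = A\<rparr>) ` Pow (parcs G)"
      by (intro image_eqI[of _ _ "parcs D"]) auto
  qed
  moreover have "finite (parcs G)" by simp
  ultimately show ?thesis by (meson finite_Pow_iff finite_imageI finite_subset)
qed

end

theory Submission
  imports Defs
begin

text \<open>
  Orient the edges greedily from a root outwards: when a vertex \<open>v\<close> is reached, only the edge to its
  parent is oriented, and all other edges at \<open>v\<close> can be oriented freely. Values of adjacent vertices
  can only collide when the degrees have the same parity. Maintaining that the value of a processed
  vertex differs from the contribution \<open>\<plusminus>1\<close> of each of its edges to an unprocessed neighbour takes
  care of the leaves, which are the only vertices without a choice: even vertices have value in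
  \<open>{-2, 0, 2}\<close>, odd vertices of degree at least 3 have value \<open>\<plusminus>3\<close>, except that a vertex of degree 3
  may be forced to \<open>\<plusminus>1\<close>, in which case all edges to its children have the same direction.

  For sharpness take the star with three leaves: if the centre had value \<open>\<plusminus>1\<close>, all leaves would have
  the opposite value, so all edges would have the same direction and the centre would have
  value \<open>\<plusminus>3\<close>.
\<close>

section \<open>In-out-degrees as sums of signs, and bounds on the orientation number\<close>

abbreviation neighbours :: "'a pair_pre_digraph \<Rightarrow> 'a \<Rightarrow> 'a set" where
  "neighbours G v \<equiv> {w. (v, w) \<in> parcs G}"

lemma (in pair_graph) finite_neighbours: "finite (neighbours G v)"
  by (rule finite_subset[of _ "snd ` parcs G"]) (force, simp)

text \<open>The sum runs over the neighbourhood in \<open>G\<close>, whatever \<open>D\<close> is,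
  so orienting the edges at \<open>v\<close> becomes a choice of signs.\<close>

lemma (in pair_graph) in_out_degree_orientation:
  assumes "orientation G D"
  shows "in_out_degree D v = (\<Sum>w\<in>neighbours G v. if (w, v) \<in> parcs D then 1 else - 1)"
proof -
  let ?N = "neighbours G v"
  have D: "parcs D \<subseteq> parcs G"
    "\<And>u w. (u, w) \<in> parcs G \<Longrightarrow> (u, w) \<in> parcs D \<longleftrightarrow> (w, u) \<notin> parcs D"
    using assms by (auto simp: orientation_def)
  have "in_arcs (with_proj D) v = (\<lambda>w. (w, v)) ` {w \<in> ?N. (w, v) \<in> parcs D}"
    using D(1) arcs_symmetric by (auto simp: in_arcs_def)
  then have i: "in_degree (with_proj D) v = card {w \<in> ?N. (w, v) \<in> parcs D}"
    by (simp add: in_degree_def card_image inj_on_def)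
  have "out_arcs (with_proj D) v = Pair v ` {w \<in> ?N. (w, v) \<notin> parcs D}"
    using D by (auto simp: out_arcs_def)
  then have o: "out_degree (with_proj D) v = card {w \<in> ?N. (w, v) \<notin> parcs D}"
    by (simp add: out_degree_def card_image inj_on_def)
  show ?thesis
    using finite_neighbours[of v]
    by (simp add: in_out_degree_def i o sum.If_cases Int_def)
qed

lemma in_out_proper_orientation_number_le:
  assumes "pair_graph G" "pverts G \<noteq> {}" "in_out_proper_orientation G D"
    and "\<And>v. v \<in> pverts G \<Longrightarrow> \<bar>in_out_degree D v\<bar> \<le> k"
  shows "in_out_proper_orientation_number G \<le> k"
proof -
  interpret pair_graph G by fact
  have "in_out_proper_orientation_number G \<le> Max ((\<lambda>v. \<bar>in_out_degree D v\<bar>) ` pverts G)"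
    unfolding in_out_proper_orientation_number_def
    using finite_in_out_proper_orientations[OF assms(1)] assms(3) by (intro Min_le) auto
  also have "\<dots> \<le> k" using assms(2,4) by (subst Max_le_iff) auto
  finally show ?thesis .
qed

text \<open>The given \<open>D\<close> keeps the set under \<open>Min\<close> nonempty; a bound
  valid for all orientations says nothing about \<open>Min {}\<close>.\<close>

lemma in_out_proper_orientation_number_ge:
  assumes "pair_graph G" "in_out_proper_orientation G D"
    and "\<And>D. in_out_proper_orientation G D \<Longrightarrow> \<exists>v\<in>pverts G. k \<le> \<bar>in_out_degree D v\<bar>"
  shows "k \<le> in_out_proper_orientation_number G"
proof -
  interpret pair_graph G by fact
  have "k \<le> Max ((\<lambda>v. \<bar>in_out_degree D v\<bar>) ` pverts G)" if D: "in_out_proper_orientation G D" for D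
  proof -
    obtain v where "v \<in> pverts G" "k \<le> \<bar>in_out_degree D v\<bar>" using assms(3)[OF D] by blast
    moreover from this have "\<bar>in_out_degree D v\<bar> \<le> Max ((\<lambda>v. \<bar>in_out_degree D v\<bar>) ` pverts G)"
      by (intro Max_ge) auto
    ultimately show ?thesis by linarith
  qed
  then show ?thesis
    unfolding in_out_proper_orientation_number_def
    using finite_in_out_proper_orientations[OF assms(1)] assms(2)
    by (subst Min_ge_iff) auto
qed

section \<open>Growing a tree from a root\<close>

text \<open>A new vertex with two neighbours in \<open>S\<close> would close a path inside
  \<open>S\<close> to a cycle of length at least 3, so every added vertex sees only its parent. This
  requires paths that stay within \<open>S\<close>, an invariant (\<open>linked\<close>) carried
  along beside \<open>P\<close>.\<close>

lemma simple_tree_induct: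
  assumes T: "simple_tree G" and r: "r \<in> pverts G" and base: "P {r}"
    and step: "\<And>S v p. \<lbrakk>S \<subseteq> pverts G; v \<in> pverts G - S; p \<in> S; neighbours G v \<inter> S = {p}; P S\<rbrakk>
      \<Longrightarrow> P (insert v S)"
  shows "P (pverts G)"
proof -
  interpret pair_graph G using T by (simp add: simple_tree_def)
  define linked where "linked S \<longleftrightarrow>
    (\<forall>x\<in>S. \<forall>y\<in>S. \<exists>es. apath x es y \<and> set (pawalk_verts x es) \<subseteq> S)" for S
  have reach: "r \<rightarrow>\<^sup>*\<^bsub>with_proj G\<^esub> v" if "v \<in> pverts G" for v
  proof -
    have "r \<rightarrow>\<^sup>*\<^bsub>with_proj (mk_symmetric G)\<^esub> v"
      using T r that unfolding simple_tree_def connected_def strongly_connected_def by simp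
    then show ?thesis using reachable_mk_symmetric_eq[OF pair_sym_arcs] by simp
  qed
  have grow: "\<exists>v p. v \<in> pverts G - S \<and> p \<in> S \<and> neighbours G v \<inter> S = {p} \<and> linked (insert v S)"
    if S: "S \<subset> pverts G" "r \<in> S" "linked S" for S
  proof -
    have "\<exists>p\<in>S. \<exists>v. v \<notin> S \<and> (p, v) \<in> parcs G"
    proof (rule ccontr)
      assume *: "\<not> ?thesis"
      have "v \<in> S" if "r \<rightarrow>\<^sup>*\<^bsub>with_proj G\<^esub> v" for v
        using that by (induction rule: reachable_induct) (use * S(2) in auto)
      with reach S(1) show False by blast
    qed
    then obtain p v where pv: "p \<in> S" "v \<notin> S" "(p, v) \<in> parcs G" by blast
    have v: "v \<in> pverts G" using pv(3) by (rule in_arcsD2)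
    have vp: "(v, p) \<in> parcs G" using pv(3) by (rule arcs_symmetric)
    have uniq: "q = p" if q: "q \<in> S" "(v, q) \<in> parcs G" for q
    proof (rule ccontr)
      assume "q \<noteq> p"
      obtain es where es: "apath p es q" "set (pawalk_verts p es) \<subseteq> S"
        using S(3) pv(1) q(1) unfolding linked_def by blast
      have ne: "es \<noteq> []" using es(1) \<open>q \<noteq> p\<close> by (auto simp: apath_Nil_iff)
      \<comment> \<open>Since \<open>q\<close> differs from \<open>p\<close>, \<open>es\<close>
        contributes at least one arc; this rules out the cycles of length 2 that every edge
        gives.\<close>
      let ?c = "(v, p) # es @ [(q, v)]"
      have qv: "(q, v) \<in> parcs G" using q(2) by (rule arcs_symmetric)
      have walk: "awalk p es q" using es(1) by (rule awalkI_apath)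
      have "awalk v ?c v"
        using walk vp qv v by (simp add: awalk_Cons_iff awalk_Nil_iff)
      moreover have "tl (pawalk_verts v ?c) = pawalk_verts p es @ [v]"
      proof -
        have "pawalk_verts p (es @ [(q, v)]) = pawalk_verts p es @ [v]"
          using walk qv v by (subst awalk_verts_append) (auto simp: awalk_simps)
        then show ?thesis by simp
      qed
      moreover have "distinct (pawalk_verts p es @ [v])"
        using es pv(2) by (auto simp: apath_def)
      ultimately have "cycle ?c" unfolding cycle_def by (intro exI[of _ v]) simp
      moreover have "3 \<le> length ?c" using ne by (cases es) auto
      ultimately show False using T unfolding simple_tree_def by blast
    qed
    have out: "\<exists>es. apath v es y \<and> set (pawalk_verts v es) \<subseteq> insert v S" if y: "y \<in> S" for y
    proof -
      obtain es where "apath p es y" "set (pawalk_verts p es) \<subseteq> S"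
        using S(3) pv(1) y unfolding linked_def by blast
      then show ?thesis using vp pv(2) by (intro exI[of _ "(v, p) # es"]) (auto simp: apath_Cons_iff)
    qed
    have into: "\<exists>es. apath y es v \<and> set (pawalk_verts y es) \<subseteq> insert v S" if y: "y \<in> S" for y
    proof -
      obtain es where "apath v es y" "set (pawalk_verts v es) \<subseteq> insert v S" using out[OF y] by blast
      then show ?thesis
        using awalk_verts_rev_path[of v es y] by (intro exI[of _ "rev_path es"]) (auto simp: apath_def)
    qed
    have "linked (insert v S)"
      unfolding linked_def
    proof (intro ballI)
      fix x y assume "x \<in> insert v S" "y \<in> insert v S"
      then consider "x = v" "y = v" | "x = v" "y \<in> S" | "x \<in> S" "y = v" | "x \<in> S" "y \<in> S" by blast
      then show "\<exists>es. apath x es y \<and> set (pawalk_verts x es) \<subseteq> insert v S"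
      proof cases
        case 1
        then show ?thesis using v by (intro exI[of _ "[]"]) (auto simp: apath_Nil_iff)
      next
        case 4
        then show ?thesis using S(3) unfolding linked_def by blast
      qed (use out into in auto)
    qed
    moreover have "neighbours G v \<inter> S = {p}" using uniq vp pv(1) by blast
    ultimately show ?thesis using v pv by blast
  qed
  have "P (pverts G)" if "S \<subseteq> pverts G" "r \<in> S" "linked S" "P S" for S
    using that
  proof (induction "card (pverts G - S)" arbitrary: S rule: less_induct)
    case less
    show ?case
    proof (cases "S = pverts G")
      case False
      then have "S \<subset> pverts G" using less.prems(1) by blast
      then obtain v p where v: "v \<in> pverts G - S" "p \<in> S" "neighbours G v \<inter> S = {p}"
        "linked (insert v S)" using grow[OF _ less.prems(2,3)] by blast
      have "card (pverts G - insert v S) < card (pverts G - S)"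
        using v(1) by (intro psubset_card_mono) auto
      then show ?thesis
      proof (rule less.hyps)
        show "P (insert v S)" using less.prems(1) v(1-3) less.prems(4) by (rule step)
      qed (use less.prems v in auto)
    qed (use less.prems in simp)
  qed
  moreover have "linked {r}"
    using r unfolding linked_def by (auto simp: apath_Nil_iff intro!: exI[of _ "[]"])
  ultimately show ?thesis using r base by blast
qed

section \<open>Choosing the signs at a single vertex\<close>

text \<open>With \<open>k\<close> signs equal to 1 the sum is \<open>2 * k - card W\<close>; the
  conditions on \<open>x\<close> say that this \<open>k\<close> is an integer between 0 and
  \<open>card W\<close>.\<close>

lemma exists_signs:
  fixes x :: int
  assumes "finite W" "\<bar>x\<bar> \<le> int (card W)" "even (x + int (card W))"
  obtains e :: "'a \<Rightarrow> int" where "\<And>w. e w \<in> {1, - 1}" "sum e W = x"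
proof -
  obtain k where k: "x + int (card W) = 2 * k" using assms(3) by (elim evenE)
  then have "0 \<le> k" "nat k \<le> card W" using assms(2) by linarith+
  then obtain A where A: "A \<subseteq> W" "card A = nat k" by (meson obtain_subset_with_card_n)
  have "finite A" using A(1) assms(1) by (rule finite_subset)
  show ?thesis
  proof (rule that[of "\<lambda>w. if w \<in> A then 1 else - 1"])
    have "W \<inter> {w. w \<in> A} = A" "W \<inter> - {w. w \<in> A} = W - A" using A by auto
    then show "(\<Sum>w\<in>W. if w \<in> A then 1 else - 1) = x"
      using assms(1) A k \<open>0 \<le> k\<close> \<open>nat k \<le> card W\<close> \<open>finite A\<close>
      by (simp add: sum.If_cases card_Diff_subset)
  qed auto
qed

text \<open>\<open>- e w\<close> is the contribution of the edge at its other end \<open>w\<close>,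
  hence the value of \<open>w\<close> if \<open>w\<close> is a leaf. The sums 0 and 3 avoid both
  signs; with a single neighbour the sum is \<open>e w\<close> itself.\<close>

lemma root_signs:
  assumes "finite W"
  obtains e :: "'a \<Rightarrow> int" where "\<And>w. e w \<in> {1, - 1}" "\<bar>sum e W\<bar> \<le> 3"
    "\<And>w. w \<in> W \<Longrightarrow> sum e W \<noteq> - e w"
proof -
  have "even (card W) \<or> card W = 1 \<or> odd (card W) \<and> 3 \<le> card W" by presburger
  then consider "even (card W)" | "card W = 1" | "odd (card W)" "3 \<le> card W" by blast
  then show ?thesis
  proof cases
    case 1
    then obtain e :: "'a \<Rightarrow> int" where e: "\<And>w. e w \<in> {1, - 1}" "sum e W = 0"
      using exists_signs[OF assms, of 0] by auto
    have "e w \<noteq> 0" for w using e(1)[of w] by auto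
    then show ?thesis using e by (intro that[of e]) auto
  next
    case 2
    then show ?thesis by (intro that[of "\<lambda>_. 1"]) auto
  next
    case 3
    then obtain e :: "'a \<Rightarrow> int" where e: "\<And>w. e w \<in> {1, - 1}" "sum e W = 3"
      using exists_signs[OF assms, of 3] by auto
    moreover have "- e w \<noteq> 3" for w using e(1)[of w] by auto
    ultimately show ?thesis by (intro that[of e]) auto
  qed
qed

text \<open>Here \<open>s\<close> is the sign of the edge to the parent, \<open>x\<close> the value
  of the parent and \<open>W\<close> the set of children. A leaf has value \<open>s\<close>, so
  \<open>x \<noteq> s\<close> is what settles the case without children.\<close>

lemma child_signs:
  fixes s x :: int
  assumes W: "finite W" and s: "s \<in> {1, - 1}" and x: "x \<noteq> s"
  obtains e :: "'a \<Rightarrow> int" where "\<And>w. e w \<in> {1, - 1}" "\<bar>s + sum e W\<bar> \<le> 3"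
    "s + sum e W \<noteq> x" "\<And>w. w \<in> W \<Longrightarrow> s + sum e W \<noteq> - e w"
proof -
  note signs = that
  \<comment> \<open>A value other than 1 and -1 never equals \<open>- e w\<close>, so avoiding
    \<open>x\<close>, the size and the parity are all that remains to check.\<close>
  have target: thesis
    if t: "\<bar>t\<bar> \<le> 3" "t \<noteq> x" "\<bar>t\<bar> \<noteq> 1" "\<bar>t - s\<bar> \<le> int (card W)" "even (t - s + int (card W))" for t
  proof -
    obtain e :: "'a \<Rightarrow> int" where e: "\<And>w. e w \<in> {1, - 1}" "sum e W = t - s"
      using exists_signs[OF W t(4,5)] by blast
    have total: "s + sum e W = t" using e(2) by simp
    have "t \<noteq> - e w" for w using e(1)[of w] t(3) by auto
    then show thesis using signs[of e] e(1) t(1,2) unfolding total by blast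
  qed
  have "card W = 0 \<or> odd (card W) \<or> card W = 2 \<or> even (card W) \<and> 4 \<le> card W" by presburger
  then consider "W = {}" | "odd (card W)" | "card W = 2" | "even (card W)" "4 \<le> card W"
    using W by auto
  then show thesis
  proof cases
    case 1
    then show thesis using s x by (intro that[of "\<lambda>_. 1"]) auto
  next
    case 2
    then have "1 \<le> card W" by presburger
    \<comment> \<open>A single child suffices to reach \<open>2 * s\<close>, whereas
      \<open>- 2 * s\<close> would take three.\<close>
    then show thesis using target[of 0] target[of "2 * s"] s 2 by (cases "x = 0") auto
  next
    case 3
    show thesis
    proof (cases "x = 3 * s")
      case True
      \<comment> \<open>Two children cannot bring the value to \<open>- 3 * s\<close>. Giving both
        the sign \<open>- s\<close> makes the total \<open>- s\<close>, while \<open>- e w\<close>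
        is \<open>s\<close>.\<close>
      then show thesis using 3 s by (intro that[of "\<lambda>_. - s"]) auto
    next
      case False
      then show thesis using target[of "3 * s"] s 3 by auto
    qed
  next
    case 4
    then show thesis using target[of 3] target[of "- 3"] s by (cases "x = 3") auto
  qed
qed

section \<open>Extending a signing vertex by vertex, and reading off an orientation\<close>

text \<open>
  The sign \<open>f u w\<close> is the contribution of the edge \<open>uw\<close> to the value of \<open>u\<close>; it is meaningful only for
  edges that meet the set \<open>S\<close> of processed vertices.
\<close>

definition partial_signing :: "'a pair_pre_digraph \<Rightarrow> 'a set \<Rightarrow> ('a \<Rightarrow> 'a \<Rightarrow> int) \<Rightarrow> bool" where
  "partial_signing G S f \<longleftrightarrow>
     (\<forall>u\<in>S. \<bar>sum (f u) (neighbours G u)\<bar> \<le> 3 \<and>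
       (\<forall>w\<in>neighbours G u. f u w \<in> {1, - 1} \<and> f w u = - f u w \<and>
         (if w \<in> S then sum (f u) (neighbours G u) \<noteq> sum (f w) (neighbours G w)
          else sum (f u) (neighbours G u) \<noteq> f w u)))"

lemma (in pair_graph) partial_signing_root: "\<exists>f. partial_signing G {r} f"
proof -
  obtain e :: "'a \<Rightarrow> int" where e: "\<And>w. e w \<in> {1, - 1}" "\<bar>sum e (neighbours G r)\<bar> \<le> 3"
    "\<And>w. w \<in> neighbours G r \<Longrightarrow> sum e (neighbours G r) \<noteq> - e w"
    using root_signs[OF finite_neighbours] by blast
  have r: "(r, r) \<notin> parcs G" using no_loops' by blast
  \<comment> \<open>For \<open>u\<close> other than \<open>r\<close> the second argument is ignored;
    only the entry at \<open>w = r\<close> matters there.\<close>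
  define f where "f u w = (if u = r then e w else - e u)" for u w
  have f: "f r = e" "\<And>w. w \<noteq> r \<Longrightarrow> f w r = - e w" by (auto simp: f_def)
  have "partial_signing G {r} f"
    unfolding partial_signing_def using e r by (auto simp: f)
  then show ?thesis by blast
qed

text \<open>\<open>child_signs\<close> is applied with \<open>f v p\<close> as \<open>s\<close> and
  the value of \<open>p\<close> as \<open>x\<close>. That they differ is the clause of
  \<open>partial_signing\<close> for the edge from \<open>p\<close> to the still unprocessed
  \<open>v\<close>.\<close>

lemma (in pair_graph) partial_signing_insert:
  assumes f: "partial_signing G S f" and v: "v \<notin> S" and p: "neighbours G v \<inter> S = {p}"
  shows "\<exists>f. partial_signing G (insert v S) f"
proof -
  let ?N = "neighbours G"
  let ?W = "?N v - {p}"
  have pS: "p \<in> S" and vp: "(v, p) \<in> parcs G" using p by auto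
  have pv: "(p, v) \<in> parcs G" using vp by (rule arcs_symmetric)
  have "p \<noteq> v" using pS v by blast
  \<comment> \<open>No child of \<open>v\<close> is processed, so new signs between \<open>v\<close>
    and \<open>?W\<close> leave all edges that meet \<open>S\<close> unchanged.\<close>
  have W: "?W \<inter> insert v S = {}" using p no_loops' by blast
  have fp: "f p v \<in> {1, - 1}" "f v p = - f p v" "sum (f p) (?N p) \<noteq> f v p"
    using f pS pv v unfolding partial_signing_def by (auto split: if_splits)
  have "finite ?W" using finite_neighbours by blast
  moreover have "f v p \<in> {1, - 1}" using fp by auto
  ultimately obtain e :: "'a \<Rightarrow> int" where e: "\<And>w. e w \<in> {1, - 1}"
    "\<bar>f v p + sum e ?W\<bar> \<le> 3" "f v p + sum e ?W \<noteq> sum (f p) (?N p)"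
    "\<And>w. w \<in> ?W \<Longrightarrow> f v p + sum e ?W \<noteq> - e w"
    using fp(3) by (rule child_signs) blast
  define g where "g u w = (if u = v \<and> w \<in> ?W then e w else if w = v \<and> u \<in> ?W then - e u else f u w)"
    for u w
  have g_old: "g u = f u" if "u \<in> S" for u
    using that v W by (auto simp: g_def fun_eq_iff)
  have g_into: "g w u = f w u" if "u \<in> S" for u w
    using that v W by (auto simp: g_def)
  have g_new: "g v w = e w" "g w v = - e w" if "w \<in> ?W" for w
    using \<open>p \<noteq> v\<close> that W by (auto simp: g_def)
  have g_vp: "g v p = f v p" using \<open>p \<noteq> v\<close> by (simp add: g_def)
  have "sum (g v) (?N v) = g v p + sum (g v) ?W"
    using vp finite_neighbours by (intro sum.remove) auto
  also have "sum (g v) ?W = sum e ?W" using g_new by (intro sum.cong) auto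
  finally have sum_v: "sum (g v) (?N v) = f v p + sum e ?W" by (simp add: g_vp)
  have "partial_signing G (insert v S) g"
    unfolding partial_signing_def
  proof (intro ballI conjI)
    fix u assume "u \<in> insert v S"
    then show "\<bar>sum (g u) (?N u)\<bar> \<le> 3"
      using f e(2) by (cases "u = v") (auto simp: sum_v g_old partial_signing_def)
  next
    fix u w assume u: "u \<in> insert v S" and w: "w \<in> ?N u"
    show "g u w \<in> {1, - 1}"
    proof (cases "u = v")
      case True
      then show ?thesis using w e(1) fp g_new g_vp by (cases "w = p") auto
    next
      case False
      then show ?thesis using f u w g_old unfolding partial_signing_def by auto
    qed
    show "g w u = - g u w"
    proof (cases "u = v")
      case True
      then show ?thesis using w fp(2) g_new g_vp g_old[OF pS] by (cases "w = p") auto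
    next
      case False
      then show ?thesis using f u w g_old g_into unfolding partial_signing_def by auto
    qed
    show "if w \<in> insert v S then sum (g u) (?N u) \<noteq> sum (g w) (?N w) else sum (g u) (?N u) \<noteq> g w u"
    proof (cases "u = v")
      case True
      show ?thesis
      proof (cases "w = p")
        case True
        then show ?thesis using e(3) pS \<open>u = v\<close> by (simp add: sum_v g_old)
      next
        case False
        then have "w \<in> ?W" using w True by simp
        then show ?thesis using e(4) W g_new True by (auto simp: sum_v)
      qed
    next
      case False
      then have uS: "u \<in> S" using u by simp
      show ?thesis
      proof (cases "w = v")
        case True
        then have "u = p" using w p uS arcs_symmetric by blast
        then show ?thesis using True e(3) pS by (simp add: sum_v g_old)
      next
        case False
        then show ?thesis
          using f uS w unfolding partial_signing_def by (auto simp: g_old g_into split: if_splits)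
      qed
    qed
  qed
  then show ?thesis by blast
qed

lemma (in pair_graph) signing_imp_in_out_proper_orientation:
  assumes f: "partial_signing G (pverts G) f"
  obtains D where "in_out_proper_orientation G D"
    "\<And>v. v \<in> pverts G \<Longrightarrow> \<bar>in_out_degree D v\<bar> \<le> 3"
proof -
  \<comment> \<open>A sign 1 at \<open>v\<close> means that the edge points to \<open>v\<close>,
    hence \<open>f v u\<close> for the arc \<open>(u, v)\<close>.\<close>
  define D where "D = \<lparr>pverts = pverts G, parcs = {(u, v) \<in> parcs G. f v u = 1}\<rparr>"
  have sign: "f u w = 1 \<or> f u w = - 1" "f w u = - f u w"
    and proper: "sum (f u) (neighbours G u) \<noteq> sum (f w) (neighbours G w)"
    if "(u, w) \<in> parcs G" for u w
    using f in_arcsD1[OF that] in_arcsD2[OF that] that unfolding partial_signing_def by auto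
  have "(u, v) \<in> parcs D \<longleftrightarrow> (v, u) \<notin> parcs D" if "(u, v) \<in> parcs G" for u v
    using sign[OF that] that arcs_symmetric[OF that] by (auto simp: D_def)
  moreover have "pverts D = pverts G" "parcs D \<subseteq> parcs G" by (auto simp: D_def)
  ultimately have orient: "orientation G D" unfolding orientation_def by blast
  have deg: "in_out_degree D v = sum (f v) (neighbours G v)" for v
    unfolding in_out_degree_orientation[OF orient]
  proof (intro sum.cong refl)
    fix w assume "w \<in> neighbours G v"
    then have w: "(v, w) \<in> parcs G" by simp
    show "(if (w, v) \<in> parcs D then 1 else - 1) = f v w"
      using sign(1)[OF w] arcs_symmetric[OF w] by (auto simp: D_def)
  qed
  show ?thesis
  proof (rule that)
    show "in_out_proper_orientation G D"
      using orient proper by (auto simp: in_out_proper_orientation_def deg)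
    show "\<bar>in_out_degree D v\<bar> \<le> 3" if "v \<in> pverts G" for v
      using f that by (simp add: deg partial_signing_def)
  qed
qed

lemma simple_tree_in_out_proper_orientation:
  assumes "simple_tree G"
  obtains D where "in_out_proper_orientation G D"
    "\<And>v. v \<in> pverts G \<Longrightarrow> \<bar>in_out_degree D v\<bar> \<le> 3"
proof -
  interpret pair_graph G using assms by (simp add: simple_tree_def)
  obtain r where "r \<in> pverts G"
    using assms by (auto simp: simple_tree_def connected_def strongly_connected_def)
  then have "\<exists>f. partial_signing G (pverts G) f"
    using partial_signing_root partial_signing_insert
    by (intro simple_tree_induct[OF assms, where P = "\<lambda>S. \<exists>f. partial_signing G S f"]) auto
  then show ?thesis using signing_imp_in_out_proper_orientation that by blast
qed

lemma in_out_proper_orientation_number_simple_tree: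
  assumes "simple_tree G"
  shows "in_out_proper_orientation_number G \<le> 3"
proof -
  have "pair_graph G" "pverts G \<noteq> {}"
    using assms by (auto simp: simple_tree_def connected_def strongly_connected_def)
  with assms show ?thesis
    by (metis in_out_proper_orientation_number_le simple_tree_in_out_proper_orientation)
qed

section \<open>Sharpness: the star with three leaves\<close>

definition claw :: "nat pair_pre_digraph" where
  "claw = \<lparr>pverts = {0, 1, 2, 3}, parcs = {0} \<times> {1, 2, 3} \<union> {1, 2, 3} \<times> {0}\<rparr>"

lemma pair_graph_claw: "pair_graph claw"
  by unfold_locales (auto simp: claw_def symmetric_def sym_def)

text \<open>Every arc has exactly one end at 0. Hence no closed walk has length 3, and a longer walk
  enters 0 twice within its first four arcs, which a cycle cannot do.\<close>

lemma simple_tree_claw: "simple_tree claw"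
proof -
  interpret pair_graph claw by (rule pair_graph_claw)
  have V: "pverts claw = {0, 1, 2, 3}" by (simp add: claw_def)
  have "0 \<rightarrow>\<^sup>*\<^bsub>with_proj claw\<^esub> v \<and> v \<rightarrow>\<^sup>*\<^bsub>with_proj claw\<^esub> 0" if "v \<in> pverts claw" for v
  proof (cases "v = 0")
    case False
    then have "(0, v) \<in> parcs claw" "(v, 0) \<in> parcs claw" using that by (auto simp: claw_def)
    then show ?thesis by auto
  qed (use that in auto)
  then have "u \<rightarrow>\<^sup>*\<^bsub>with_proj claw\<^esub> v" if "u \<in> pverts claw" "v \<in> pverts claw" for u v
    using that by (blast intro: reachable_trans)
  then have "connected claw"
    unfolding connected_def strongly_connected_def
    by (simp add: reachable_mk_symmetric_eq[OF pair_sym_arcs] V)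
  moreover have "\<not> cycle p" if len: "3 \<le> length p" for p
  proof
    assume "cycle p"
    then obtain u where u: "awalk u p u" "distinct (tl (pawalk_verts u p))"
      unfolding cycle_def by auto
    obtain e1 e2 e3 q where p: "p = e1 # e2 # e3 # q"
      using len unfolding numeral_3_eq_3 Suc_le_length_iff by blast
    have arc: "fst e = 0 \<longleftrightarrow> snd e \<noteq> 0" if "e \<in> parcs claw" for e
      using that by (auto simp: claw_def)
    have "e1 \<in> parcs claw" "e2 \<in> parcs claw" "e3 \<in> parcs claw"
      and ends: "fst e1 = u" "fst e2 = snd e1" "fst e3 = snd e2"
      using u(1) by (auto simp: p awalk_Cons_iff)
    note arcs = arc[OF this(1)] arc[OF this(2)] arc[OF this(3)]
    show False
    proof (cases q)
      case Nil
      then have "snd e3 = u" using u(1) by (auto simp: p awalk_Cons_iff awalk_Nil_iff)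
      then show False using arcs ends by auto
    next
      case (Cons e4 q')
      then have e4: "e4 \<in> parcs claw" "fst e4 = snd e3" using u(1) by (auto simp: p awalk_Cons_iff)
      \<comment> \<open>Vertex lists record tails of arcs, so for nonempty \<open>q'\<close> the
        entry \<open>snd e4\<close> appears only as the tail of the next arc.\<close>
      have "snd e4 \<in> set (pawalk_verts (snd e4) q')"
        by (cases q') (use u(1) in \<open>auto simp: p Cons awalk_Cons_iff\<close>)
      then have "snd e1 \<noteq> snd e3" "snd e2 \<noteq> snd e4"
        using u(2) ends e4 by (auto simp: p Cons)
      then show False using arcs ends arc[OF e4(1)] e4(2) by auto
    qed
  qed
  ultimately show ?thesis using pair_graph_claw unfolding simple_tree_def by blast
qed

text \<open>If the directions are mixed, the centre has value 1 or -1, and the leaf whose edge goes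
  against the other two has the same value.\<close>

lemma claw_in_out_degree_ge:
  assumes "in_out_proper_orientation claw D"
  shows "3 \<le> \<bar>in_out_degree D 0\<bar>"
proof -
  interpret pair_graph claw by (rule pair_graph_claw)
  have D: "orientation claw D" using assms by (simp add: in_out_proper_orientation_def)
  have N: "neighbours claw 0 = {1, 2, 3}" "neighbours claw 1 = {0}" "neighbours claw 2 = {0}"
    "neighbours claw 3 = {0}" by (auto simp: claw_def)
  have arcs: "(0, 1) \<in> parcs claw" "(0, 2) \<in> parcs claw" "(0, 3) \<in> parcs claw"
    by (auto simp: claw_def)
  then have "in_out_degree D 0 \<noteq> in_out_degree D 1" "in_out_degree D 0 \<noteq> in_out_degree D 2"
    "in_out_degree D 0 \<noteq> in_out_degree D 3"
    using assms by (auto simp: in_out_proper_orientation_def)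
  moreover have "(0, 1) \<in> parcs D \<longleftrightarrow> (1, 0) \<notin> parcs D" "(0, 2) \<in> parcs D \<longleftrightarrow> (2, 0) \<notin> parcs D"
    "(0, 3) \<in> parcs D \<longleftrightarrow> (3, 0) \<notin> parcs D"
    using D arcs by (auto simp: orientation_def)
  ultimately show ?thesis
    unfolding in_out_degree_orientation[OF D] N by (simp split: if_splits)
qed

theorem theorem2:
  shows "(\<forall>T :: 'a pair_pre_digraph. simple_tree T \<longrightarrow> in_out_proper_orientation_number T \<le> 3) \<and>
         (\<exists>T :: nat pair_pre_digraph. simple_tree T \<and> in_out_proper_orientation_number T = 3)"
proof (intro conjI allI impI exI)
  show "simple_tree claw" by (rule simple_tree_claw)
  obtain D where "in_out_proper_orientation claw D"
    using simple_tree_in_out_proper_orientation[OF simple_tree_claw] by blast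
  then have "3 \<le> in_out_proper_orientation_number claw"
    using claw_in_out_degree_ge
    by (intro in_out_proper_orientation_number_ge[OF pair_graph_claw])
      (auto intro!: bexI[of _ 0] simp: claw_def)
  then show "in_out_proper_orientation_number claw = 3"
    using in_out_proper_orientation_number_simple_tree[OF simple_tree_claw] by simp
qed (rule in_out_proper_orientation_number_simple_tree)

end
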